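(* For each $n$ let $N=\binom n2$, let $\alpha=(\alpha_e)_{e\in E_n}$ be $M$-bounded with $M=M(n)=O(1)$, and let $G_{\Sigma,p}$ be the random graph on $[n]$ defined by a uniform random point of the simplex $\Sigma=\{X\in\mathbb{R}_+^N:\sum_{e\in E_n}\alpha_eX_e\le N\}$. Then every monotone increasing graph property $\mathcal{P}$ has a threshold in the model $G_{\Sigma,p}$.
   Context: $[n]=\{1,\dots,n\}$ and $E_n=\binom{[n]}{2}$ is the set of unordered pairs of vertices, so $|E_n|=N$. The vector $\alpha$ is $M$-bounded if $1/M\le\alpha_e\le M$ for all $e\in E_n$. Choose $X$ uniformly at random from $\Sigma$; $G_{\Sigma,p}$ is the graph with vertex set $[n]$ whose edges are the pairs $e$ with $X_e\le p$. A graph property is a family of graphs closed under isomorphism; it is monotone increasing if it is preserved under adding edges; as usual, the property is taken to be nontrivial (for each $n$, some but not all graphs on $[n]$ have it). A function $p_0=p_0(n)$ is a threshold for a monotone increasing property $\mathcal{P}$ if $p/p_0\to0$ implies $\Pr(G_{\Sigma,p}\in\mathcal{P})\to0$ and $p/p_0\to\infty$ implies $\Pr(G_{\Sigma,p}\in\mathcal{P})\to1$. *)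

theory Defs
  imports "HOL-Probability.Probability" "HOL-Library.Ramsey" "HOL-Library.Landau_Symbols"
begin

text \<open>A simple graph is a pair of a vertex set and an edge set; edges are 2-element sets of
  vertices, and \<open>nsets V 2\<close> (from \<^theory>\<open>HOL-Library.Ramsey\<close>) is the set of all of them.\<close>

type_synonym 'a graph = "'a set \<times> 'a set set"

definition simple_graph :: "'a graph \<Rightarrow> bool" where
  "simple_graph G \<longleftrightarrow> snd G \<subseteq> nsets (fst G) 2"

definition graph_iso :: "'a graph \<Rightarrow> 'b graph \<Rightarrow> bool" where
  "graph_iso G H \<longleftrightarrow> simple_graph G \<and> simple_graph H \<and>
     (\<exists>f. bij_betw f (fst G) (fst H) \<and>
          (\<forall>u\<in>fst G. \<forall>v\<in>fst G. {u, v} \<in> snd G \<longleftrightarrow> {f u, f v} \<in> snd H))"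

definition graph_property :: "'a graph set \<Rightarrow> bool" where
  "graph_property P \<longleftrightarrow>
     (\<forall>G\<in>P. simple_graph G) \<and> (\<forall>G\<in>P. \<forall>H. graph_iso G H \<longrightarrow> H \<in> P)"

definition monotone_increasing :: "'a graph set \<Rightarrow> bool" where
  "monotone_increasing P \<longleftrightarrow>
     (\<forall>V E E'. (V, E) \<in> P \<and> E \<subseteq> E' \<and> simple_graph (V, E') \<longrightarrow> (V, E') \<in> P)"

text \<open>There is only one graph on \<open>{1..n}\<close> when \<open>n < 2\<close>, so requiring both a graph with and a graph
  without the property is meaningful only for \<open>n \<ge> 2\<close>.\<close>

definition nontrivial_property :: "nat graph set \<Rightarrow> bool" where
  "nontrivial_property P \<longleftrightarrow>
     (\<forall>n\<ge>2. (\<exists>E. simple_graph ({1..n}, E) \<and> ({1..n}, E) \<in> P) \<and>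
            (\<exists>E. simple_graph ({1..n}, E) \<and> ({1..n}, E) \<notin> P))"

definition edge_pairs :: "nat \<Rightarrow> nat set set" where
  "edge_pairs n = nsets {1..n} 2"

text \<open>The conjunct \<open>0 < K\<close> is not redundant: with \<open>K \<le> 0\<close> the two inequalities alone would admit
  nonpositive coefficients.\<close>

definition M_bounded :: "real \<Rightarrow> nat \<Rightarrow> (nat set \<Rightarrow> real) \<Rightarrow> bool" where
  "M_bounded K n a \<longleftrightarrow> 0 < K \<and> (\<forall>e\<in>edge_pairs n. 1 / K \<le> a e \<and> a e \<le> K)"

text \<open>Points of the space of real vectors indexed by the pairs are extensional functions on
  \<open>edge_pairs n\<close>, the points of the product measure.\<close>

definition weighted_simplex :: "nat \<Rightarrow> (nat set \<Rightarrow> real) \<Rightarrow> (nat set \<Rightarrow> real) set" where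
  "weighted_simplex n a = {X \<in> (\<Pi>\<^sub>E e\<in>edge_pairs n. {0..}). (\<Sum>e\<in>edge_pairs n. a e * X e) \<le> real (n choose 2)}"

definition uniform_simplex :: "nat \<Rightarrow> (nat set \<Rightarrow> real) \<Rightarrow> (nat set \<Rightarrow> real) measure" where
  "uniform_simplex n a = uniform_measure (\<Pi>\<^sub>M e\<in>edge_pairs n. lborel) (weighted_simplex n a)"

definition simplex_graph :: "nat \<Rightarrow> real \<Rightarrow> (nat set \<Rightarrow> real) \<Rightarrow> nat graph" where
  "simplex_graph n p X = ({1..n}, {e \<in> edge_pairs n. X e \<le> p})"

definition prob_property :: "nat \<Rightarrow> (nat set \<Rightarrow> real) \<Rightarrow> real \<Rightarrow> nat graph set \<Rightarrow> real" where
  "prob_property n a p P = \<P>(X in uniform_simplex n a. simplex_graph n p X \<in> P)"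

text \<open>Positivity of \<open>p0\<close> makes the quotients \<open>p n / p0 n\<close> genuine (division by zero yields zero).\<close>

definition is_threshold ::
  "(nat \<Rightarrow> nat set \<Rightarrow> real) \<Rightarrow> nat graph set \<Rightarrow> (nat \<Rightarrow> real) \<Rightarrow> bool" where
  "is_threshold \<alpha> P p0 \<longleftrightarrow> (\<forall>n. 0 < p0 n) \<and>
     (\<forall>p. (\<lambda>n. p n / p0 n) \<longlonglongrightarrow> 0 \<longrightarrow> (\<lambda>n. prob_property n (\<alpha> n) (p n) P) \<longlonglongrightarrow> 0) \<and>
     (\<forall>p. filterlim (\<lambda>n. p n / p0 n) at_top sequentially \<longrightarrow>
          (\<lambda>n. prob_property n (\<alpha> n) (p n) P) \<longlonglongrightarrow> 1)"

end

theory Submission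
  imports Defs "HOL-Real_Asymp.Real_Asymp"
begin

text \<open>The simplex model is compared with the model in which each pair \<open>e\<close> is present independently
  with probability \<open>1 - exp (- \<alpha>\<^sub>e p)\<close>. The latter satisfies the Bollobas--Thomason argument
  exactly: the union of independent copies at \<open>p\<close> and \<open>q\<close> is a copy at \<open>p + q\<close>, so the
  probability of missing an increasing family is submultiplicative in \<open>p\<close>, and every median is a
  threshold. On the other hand, writing \<open>exp (- s)\<close> as the integral of \<open>exp (- t)\<close> over
  \<open>t \<ge> s\<close> slices the product of exponential densities into simplices, and rescaling each slice
  gives \<open>g p = E (f (p N / T))\<close>, where \<open>f\<close> and \<open>g\<close> are the probabilities of the property in the
  simplex and the independent model and \<open>T\<close> is Gamma distributed with shape \<open>N + 1\<close>. Since \<open>T\<close>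
  lies in \<open>[N/2, 2N]\<close> with probability \<open>1 - o(1)\<close>, \<open>f\<close> and \<open>g\<close> agree up to a factor 2 in the
  argument and an error \<open>o(1)\<close>.\<close>

section \<open>Bernoulli and exponential laws, dilation of Lebesgue measure, concentration of the
  Gamma law\<close>

text \<open>Two independent coins both fail with probability exp(-bp) exp(-bq) = exp(-b(p+q)). This
  parametrization is what makes parameters add under unions.\<close>

lemma bernoulli_pmf_exp_add:
  fixes b p q :: real
  assumes "0 \<le> b" "0 \<le> p" "0 \<le> q"
  shows "bernoulli_pmf (1 - exp (- b * (p + q))) =
    bernoulli_pmf (1 - exp (- b * p)) \<bind>
      (\<lambda>x. map_pmf (\<lambda>y. x \<or> y) (bernoulli_pmf (1 - exp (- b * q))))"
proof (rule pmf_eqI)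
  fix z
  have E: "1 - exp (- b * (p + q)) = 1 - exp (- b * p) * exp (- b * q)"
    by (simp add: algebra_simps flip: exp_add)
  define u v where "u = exp (- b * p)" and "v = exp (- b * q)"
  have u: "0 \<le> 1 - u" "1 - u \<le> 1" and v: "0 \<le> 1 - v" "1 - v \<le> 1"
    using assms by (auto simp: u_def v_def)
  have uv: "0 \<le> 1 - u * v" "1 - u * v \<le> 1"
    using u v by (auto simp: mult_le_one)
  have T: "map_pmf (\<lambda>y. True \<or> y) M = return_pmf True"
      "map_pmf (\<lambda>y. False \<or> y) M = M" for M :: "bool pmf"
    by simp_all
  show "pmf (bernoulli_pmf (1 - exp (- b * (p + q)))) z =
    pmf (bernoulli_pmf (1 - exp (- b * p)) \<bind>
      (\<lambda>x. map_pmf (\<lambda>y. x \<or> y) (bernoulli_pmf (1 - exp (- b * q))))) z"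
    unfolding E pmf_bind u_def[symmetric] v_def[symmetric] integral_bernoulli_pmf[OF u] T
    using u v uv by (cases z) (simp_all add: algebra_simps)
qed

text \<open>Bernoulli's inequality bounds the second factor by (1+x)^m, and (1-x)(1+x) is at most 1.
  It turns a lower bound on (1-x)^m into an upper bound on x of order 1/m.\<close>

lemma power_one_minus_le:
  fixes x :: real
  assumes "0 \<le> x" "x \<le> 1"
  shows "(1 - x) ^ m * (1 + real m * x) \<le> 1"
proof -
  have "(1 - x) ^ m * (1 + real m * x) \<le> (1 - x) ^ m * (1 + x) ^ m"
    using assms by (intro mult_left_mono Bernoulli_inequality) auto
  also have "\<dots> = (1 - x\<^sup>2) ^ m"
    by (simp add: power2_eq_square algebra_simps flip: power_mult_distrib)
  also have "\<dots> \<le> 1"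
    using assms by (intro power_le_one) (auto simp: power_le_one)
  finally show ?thesis .
qed

lemma tendsto_exp_neg_mult_at_top:
  fixes b :: real
  assumes "0 < b"
  shows "((\<lambda>x. - exp (- b * x) / b) \<longlongrightarrow> 0) at_top"
proof -
  have "filterlim (\<lambda>x. - b * x) at_bot at_top"
    using assms by (intro filterlim_tendsto_neg_mult_at_bot[OF tendsto_const]) (auto simp: filterlim_ident)
  then have "((\<lambda>x. exp (- b * x)) \<longlongrightarrow> 0) at_top"
    by (rule filterlim_compose[OF exp_at_bot])
  then show ?thesis
    using tendsto_divide[of _ 0 at_top "\<lambda>_. - b" "- b"] assms by fastforce
qed

text \<open>Serves twice: for the mass of an absent coordinate, and with b = 1 for writing exp(-s)
  as an integral over the half-line from s.\<close>

lemma nn_integral_exp_atLeast: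
  fixes b p :: real
  assumes "0 < b"
  shows "(\<integral>\<^sup>+x. ennreal (exp (- b * x)) * indicator {p..} x \<partial>lborel) = ennreal (exp (- b * p) / b)"
proof -
  have "(\<integral>\<^sup>+x. ennreal (exp (- b * x)) * indicator {p..} x \<partial>lborel) = ennreal (0 - (- exp (- b * p) / b))"
    using assms tendsto_exp_neg_mult_at_top[OF assms]
    by (intro nn_integral_FTC_atLeast) (auto intro!: derivative_eq_intros)
  then show ?thesis by simp
qed

lemma nn_integral_exp_Icc:
  fixes b p :: real
  assumes "0 < b" "0 \<le> p"
  shows "(\<integral>\<^sup>+x. ennreal (exp (- b * x)) * indicator {0..p} x \<partial>lborel) = ennreal ((1 - exp (- b * p)) / b)"
proof -
  have "(\<integral>\<^sup>+x. ennreal (exp (- b * x)) * indicator {0..p} x \<partial>lborel) =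
      ennreal (- exp (- b * p) / b - (- exp (- b * 0) / b))"
    using assms by (intro nn_integral_FTC_Icc) (auto intro!: derivative_eq_intros)
  then show ?thesis by (simp add: diff_divide_distrib)
qed

interpretation real_product: product_sigma_finite "\<lambda>_. lborel :: real measure"
  by (simp add: product_sigma_finite_def lborel.sigma_finite_measure_axioms)

text \<open>A product measure is determined by its values on boxes, and there the claim splits into
  one-dimensional dilations, each contributing one factor c.\<close>

lemma scale_PiM_lborel:
  fixes c :: real
  assumes "finite I" "0 < c"
  shows "scale_measure (ennreal (c ^ card I))
      (distr (\<Pi>\<^sub>M e\<in>I. lborel) (\<Pi>\<^sub>M e\<in>I. lborel) (\<lambda>X. \<lambda>e\<in>I. c * X e)) = (\<Pi>\<^sub>M e\<in>I. lborel)"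
    (is "scale_measure _ (distr ?L _ ?s) = _")
proof (rule real_product.PiM_eqI[OF assms(1)])
  have [measurable]: "?s \<in> measurable ?L ?L"
    by (intro measurable_restrict) measurable
  fix A :: "'a \<Rightarrow> real set"
  assume A: "\<And>i. i \<in> I \<Longrightarrow> A i \<in> sets lborel"
  have pre: "?s -` Pi\<^sub>E I A \<inter> space ?L = (\<Pi>\<^sub>E e\<in>I. (*) c -` A e)"
    by (auto simp: space_PiM PiE_iff)
  have one: "ennreal c * emeasure lborel ((*) c -` B) = emeasure lborel B" if "B \<in> sets borel" for B
  proof -
    have "emeasure lborel ((*) c -` B) = emeasure (density lborel (\<lambda>_. ennreal (inverse \<bar>c\<bar>))) B"
      using that assms(2) by (subst lborel_distr_mult[symmetric]) (auto simp: emeasure_distr)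
    also have "\<dots> = ennreal (inverse c) * emeasure lborel B"
      using that assms(2) by (simp add: emeasure_density nn_integral_cmult_indicator)
    finally show ?thesis
      using assms(2) by (simp add: mult.assoc[symmetric] ennreal_mult[symmetric])
  qed
  have "emeasure (scale_measure (ennreal (c ^ card I)) (distr ?L ?L ?s)) (Pi\<^sub>E I A) =
      ennreal (c ^ card I) * emeasure ?L (\<Pi>\<^sub>E e\<in>I. (*) c -` A e)"
    using A assms(1) by (simp add: emeasure_distr sets_PiM_I_finite pre)
  also have "emeasure ?L (\<Pi>\<^sub>E e\<in>I. (*) c -` A e) = (\<Prod>e\<in>I. emeasure lborel ((*) c -` A e))"
  proof (rule real_product.emeasure_PiM[OF assms(1)])
    fix i assume "i \<in> I"
    with A have "A i \<in> sets borel" by simp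
    then have "(*) c -` A i \<inter> space borel \<in> sets borel"
      by (rule measurable_sets[rotated]) simp
    then show "(*) c -` A i \<in> sets lborel" by simp
  qed
  also have "ennreal (c ^ card I) * \<dots> = (\<Prod>e\<in>I. ennreal c * emeasure lborel ((*) c -` A e))"
    using assms(2) by (simp add: prod.distrib ennreal_power)
  also have "\<dots> = (\<Prod>e\<in>I. emeasure lborel (A e))"
    using A one by (intro prod.cong) auto
  finally show "emeasure (scale_measure (ennreal (c ^ card I)) (distr ?L ?L ?s)) (Pi\<^sub>E I A) =
      (\<Prod>e\<in>I. emeasure lborel (A e))" .
qed simp

lemma nn_integral_erlang_density_eq_1: "(\<integral>\<^sup>+t. ennreal (erlang_density k 1 t) \<partial>lborel) = 1"
  using nn_integral_erlang_ith_moment[of 1 k 0] by simp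

text \<open>The Chebyshev bound: the variance N + 1 of the Gamma law of shape N + 1, divided by
  (N/2)^2.\<close>

definition gamma_tail_bound :: "nat \<Rightarrow> real" where
  "gamma_tail_bound N = 4 * (real N + 1) / real N ^ 2"

text \<open>Chebyshev's inequality at distance N/2. The law with \<open>erlang_density N 1\<close>
  has shape N + 1, not N, so its mean and variance are both N + 1.\<close>

lemma erlang_tail:
  assumes "0 < N"
  shows "emeasure (density lborel (erlang_density N 1)) {t. real N / 2 \<le> \<bar>t - real (N + 1)\<bar>}
    \<le> ennreal (gamma_tail_bound N)"
proof -
  let ?D = "density lborel (erlang_density N 1)"
  interpret prob_space ?D
    by (rule prob_space_erlang_density) simp
  have D: "distributed ?D lborel (\<lambda>x. x) (erlang_density N 1)"
    unfolding distributed_def by (auto simp: distr_id2)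
  have E: "expectation (\<lambda>x. x) = real (N + 1)"
    using erlang_ith_moment[OF _ D, of 1] by simp
  have V: "variance (\<lambda>x. x) = real N + 1"
    using erlang_distributed_variance[OF _ D] by simp
  have "prob {x \<in> space ?D. \<bar>x - expectation (\<lambda>x. x)\<bar> \<ge> real N / 2} \<le> variance (\<lambda>x. x) / (real N / 2)\<^sup>2"
    using assms erlang_ith_moment_integrable[OF _ D, of 2]
    by (intro Chebyshev_inequality) auto
  then have "prob {t. real N / 2 \<le> \<bar>t - real (N + 1)\<bar>} \<le> (real N + 1) / (real N / 2)\<^sup>2"
    unfolding V unfolding E by simp
  also have "\<dots> = gamma_tail_bound N"
    by (simp add: power_divide gamma_tail_bound_def)
  finally show ?thesis
    unfolding emeasure_eq_measure by (rule ennreal_leI)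
qed

subsection \<open>Independent edges\<close>

text \<open>Pairs of vertices are abstracted to a finite index set; a graph property on a fixed
  vertex set then becomes a family \<open>Q\<close> of index sets.\<close>

locale exponential_weights =
  fixes I :: "'i set" and a :: "'i \<Rightarrow> real"
  assumes finite_I: "finite I" and a_pos: "\<And>e. e \<in> I \<Longrightarrow> 0 < a e"
begin

text \<open>For nonnegative p, this is the law of the set of indices whose independent exponential
  clock of rate \<open>a e\<close> has rung by time p. The default \<open>False\<close> keeps
  indices outside \<open>I\<close> absent.\<close>

definition random_subset :: "real \<Rightarrow> 'i set pmf" where
  "random_subset p =
     map_pmf (\<lambda>f. {e \<in> I. f e}) (Pi_pmf I False (\<lambda>e. bernoulli_pmf (1 - exp (- a e * p))))"

lemma set_random_subset: "set_pmf (random_subset p) \<subseteq> Pow I"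
  by (auto simp: random_subset_def)

lemma pmf_random_subset:
  assumes "0 \<le> p" "S \<subseteq> I"
  shows "pmf (random_subset p) S =
    (\<Prod>e\<in>I. if e \<in> S then 1 - exp (- a e * p) else exp (- a e * p))"
proof -
  have "(\<lambda>f. {e \<in> I. f e}) -` {S} = Pi I (\<lambda>e. {e \<in> S})"
    using assms(2) by (auto simp: Pi_def)
  then have "pmf (random_subset p) S =
      (\<Prod>e\<in>I. measure_pmf.prob (bernoulli_pmf (1 - exp (- a e * p))) {e \<in> S})"
    unfolding random_subset_def pmf_map by (simp add: measure_Pi_pmf_Pi finite_I)
  also have "\<dots> = (\<Prod>e\<in>I. if e \<in> S then 1 - exp (- a e * p) else exp (- a e * p))"
  proof (rule prod.cong)
    fix e assume "e \<in> I"
    \<comment> \<open>This puts 1 - exp(- a e * p) in the unit interval, so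
      \<open>bernoulli_pmf\<close> does not clip its parameter.\<close>
    then have "0 \<le> a e * p"
      using a_pos[of e] assms(1) by simp
    then show "measure_pmf.prob (bernoulli_pmf (1 - exp (- a e * p))) {e \<in> S} =
        (if e \<in> S then 1 - exp (- a e * p) else exp (- a e * p))"
      by (cases "e \<in> S") (auto simp: measure_pmf_single)
  qed simp
  finally show ?thesis .
qed

text \<open>The coin identity holds in each coordinate, products commute with \<open>bind\<close>,
  and a coordinatewise disjunction of indicators is a union of sets.\<close>

lemma random_subset_add:
  assumes "0 \<le> p" "0 \<le> q"
  shows "random_subset (p + q) =
    map_pmf (\<lambda>(S, T). S \<union> T) (pair_pmf (random_subset p) (random_subset q))"
proof -
  let ?B = "\<lambda>r. Pi_pmf I False (\<lambda>e. bernoulli_pmf (1 - exp (- a e * r)))"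
  have "?B (p + q) = Pi_pmf I False (\<lambda>e. bernoulli_pmf (1 - exp (- a e * p)) \<bind>
      (\<lambda>x. map_pmf (\<lambda>y. x \<or> y) (bernoulli_pmf (1 - exp (- a e * q)))))"
    by (intro Pi_pmf_cong refl bernoulli_pmf_exp_add) (use a_pos assms in \<open>auto simp: less_imp_le\<close>)
  also have "\<dots> = ?B p \<bind> (\<lambda>f. ?B q \<bind> (\<lambda>h. return_pmf (\<lambda>e. if e \<in> I then f e \<or> h e else False)))"
    unfolding map_pmf_def
    by (subst Pi_pmf_bind[OF finite_I, where d' = False], subst Pi_pmf_bind[OF finite_I, where d' = False],
        subst Pi_pmf_return_pmf[OF finite_I]) (rule refl)
  finally have "?B (p + q) = \<dots>" .
  moreover have "{e \<in> I. f e \<or> h e} = {e \<in> I. f e} \<union> {e \<in> I. h e}" for f h :: "'i \<Rightarrow> bool"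
    by auto
  ultimately show ?thesis
    unfolding random_subset_def
    by (simp add: pair_pmf_def map_pmf_def bind_assoc_pmf bind_return_pmf cong: conj_cong)
qed

definition hit_prob :: "'i set set \<Rightarrow> real \<Rightarrow> real" where
  "hit_prob Q p = measure_pmf.prob (random_subset p) Q"

lemma hit_prob_nonneg: "0 \<le> hit_prob Q p"
  and hit_prob_le_1: "hit_prob Q p \<le> 1"
  unfolding hit_prob_def by simp_all

text \<open>Sets outside \<open>Pow I\<close> carry no mass, so an arbitrary, possibly infinite,
  \<open>Q\<close> reduces to a finite sum.\<close>

lemma hit_prob_eq_sum: "hit_prob Q p = (\<Sum>S\<in>Pow I \<inter> Q. pmf (random_subset p) S)"
proof -
  have "hit_prob Q p = measure_pmf.prob (random_subset p) (Pow I \<inter> Q)"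
    unfolding hit_prob_def
    by (rule measure_prob_cong_0) (use set_random_subset[of p] in \<open>auto simp: set_pmf_eq\<close>)
  also have "\<dots> = (\<Sum>S\<in>Pow I \<inter> Q. pmf (random_subset p) S)"
    by (rule measure_measure_pmf_finite) (simp add: finite_I)
  finally show ?thesis .
qed

text \<open>The single outcome \<open>I\<close> already has positive mass.\<close>

lemma hit_prob_pos:
  assumes "0 < p" "I \<in> Q"
  shows "0 < hit_prob Q p"
proof -
  have "0 < pmf (random_subset p) I"
    using assms a_pos by (auto simp: pmf_random_subset intro!: prod_pos)
  also have "\<dots> \<le> hit_prob Q p"
    unfolding hit_prob_eq_sum using assms finite_I by (intro member_le_sum) auto
  finally show ?thesis .
qed

lemma hit_prob_less_1:
  assumes "0 < p" "{} \<notin> Q"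
  shows "hit_prob Q p < 1"
proof -
  have "0 < pmf (random_subset p) {}"
    using assms a_pos by (auto simp: pmf_random_subset intro!: prod_pos)
  also have "\<dots> = measure_pmf.prob (random_subset p) {{}}"
    by (simp add: measure_pmf_single)
  also have "\<dots> \<le> measure_pmf.prob (random_subset p) (UNIV - Q)"
    using assms by (intro measure_pmf.finite_measure_mono) auto
  also have "\<dots> = 1 - hit_prob Q p"
    unfolding hit_prob_def using measure_pmf.prob_compl[of Q "random_subset p"] by simp
  finally show ?thesis by simp
qed

section \<open>Submultiplicativity of missing an increasing family, and multiples of a
  median\<close>

definition increasing :: "'i set set \<Rightarrow> bool" where
  "increasing Q \<longleftrightarrow> (\<forall>S\<in>Q. \<forall>T. S \<subseteq> T \<and> T \<subseteq> I \<longrightarrow> T \<in> Q)"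

text \<open>If the union of two independent copies misses \<open>Q\<close>, then so does each
  copy.\<close>

lemma miss_prob_submult:
  assumes "increasing Q" "0 \<le> p" "0 \<le> q"
  shows "1 - hit_prob Q (p + q) \<le> (1 - hit_prob Q p) * (1 - hit_prob Q q)"
proof -
  let ?R = "random_subset" and ?B = "Pow I - Q"
  \<comment> \<open>The complement is cut down to \<open>Pow I\<close>: it becomes finite, as the
    product rule wants a countable set, and \<open>increasing\<close> applies to unions inside
    \<open>I\<close>.\<close>
  have miss: "1 - hit_prob Q r = measure_pmf.prob (?R r) ?B" for r
  proof -
    have "1 - hit_prob Q r = measure_pmf.prob (?R r) (UNIV - Q)"
      unfolding hit_prob_def using measure_pmf.prob_compl[of Q "?R r"] by simp
    also have "\<dots> = measure_pmf.prob (?R r) ?B"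
      by (rule measure_prob_cong_0) (use set_random_subset[of r] in \<open>auto simp: set_pmf_eq\<close>)
    finally show ?thesis .
  qed
  have "1 - hit_prob Q (p + q) =
      measure_pmf.prob (pair_pmf (?R p) (?R q)) ((\<lambda>(S, T). S \<union> T) -` ?B)"
    unfolding miss random_subset_add[OF assms(2,3)] by simp
  also have "\<dots> \<le> measure_pmf.prob (pair_pmf (?R p) (?R q)) (?B \<times> ?B)"
    using assms(1) by (intro measure_pmf.finite_measure_mono) (auto simp: increasing_def)
  also have "\<dots> = (1 - hit_prob Q p) * (1 - hit_prob Q q)"
    unfolding miss by (rule measure_pmf_prob_product) (auto intro!: countable_finite simp: finite_I)
  finally show ?thesis .
qed

lemma miss_prob_le_power:
  assumes "increasing Q" "0 \<le> p"
  shows "1 - hit_prob Q (real m * p) \<le> (1 - hit_prob Q p) ^ m"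
proof (induction m)
  case 0
  then show ?case by (simp add: hit_prob_nonneg)
next
  case (Suc m)
  have "1 - hit_prob Q (real (Suc m) * p) = 1 - hit_prob Q (p + real m * p)"
    by (simp add: algebra_simps)
  also have "\<dots> \<le> (1 - hit_prob Q p) * (1 - hit_prob Q (real m * p))"
    using assms by (intro miss_prob_submult) auto
  also have "\<dots> \<le> (1 - hit_prob Q p) * (1 - hit_prob Q p) ^ m"
    using Suc hit_prob_le_1[of Q p] by (intro mult_left_mono) auto
  finally show ?case by simp
qed

text \<open>Sprinkling: a copy at q contains one at p, the surplus being an independent copy at q -
  p.\<close>

lemma hit_prob_mono:
  assumes "increasing Q" "0 \<le> p" "p \<le> q"
  shows "hit_prob Q p \<le> hit_prob Q q"
proof -
  have "1 - hit_prob Q (p + (q - p)) \<le> (1 - hit_prob Q p) * (1 - hit_prob Q (q - p))"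
    using assms by (intro miss_prob_submult) auto
  also have "\<dots> \<le> (1 - hit_prob Q p) * 1"
    using hit_prob_le_1[of Q p] hit_prob_nonneg[of Q "q - p"] by (intro mult_left_mono) auto
  finally show ?thesis by simp
qed

text \<open>A slack factor 2 replaces continuity. On a grid that starts below the level 1/2 and
  eventually exceeds it, two consecutive points enclose the crossing, and their ratio is at most
  2.\<close>

lemma ex_median:
  assumes Q: "increasing Q" "I \<in> Q" "{} \<notin> Q"
  shows "\<exists>p0>0. hit_prob Q p0 \<le> 1/2 \<and> 1/2 \<le> hit_prob Q (2 * p0)"
proof -
  have pos: "0 < hit_prob Q 1" and lt: "hit_prob Q 1 < 1"
    using Q by (auto intro: hit_prob_pos hit_prob_less_1)
  obtain k where k: "0 < k" "hit_prob Q (1 / real k) < 1/2"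
  proof -
    \<comment> \<open>With x the value at 1/(2k), this choice leads to 1 + 2kx < k, hence x < 1/2.
      The witness handed over at the end is therefore \<open>2 * k\<close>.\<close>
    obtain k :: nat where k: "1 / (1 - hit_prob Q 1) < real k"
      using reals_Archimedean2 by blast
    moreover have "0 < 1 / (1 - hit_prob Q 1)" using lt by simp
    ultimately have k0: "0 < real k" by linarith
    then have c: "1 - hit_prob Q 1 \<le> (1 - hit_prob Q (1 / (2 * real k))) ^ (2 * k)"
      using miss_prob_le_power[OF Q(1), of "1 / (2 * real k)" "2 * k"] by simp
    let ?x = "hit_prob Q (1 / (2 * real k))"
    have "(1 - hit_prob Q 1) * (1 + 2 * real k * ?x) \<le> (1 - ?x) ^ (2 * k) * (1 + 2 * real k * ?x)"
      using c hit_prob_nonneg[of Q "1 / (2 * real k)"] by (intro mult_right_mono) auto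
    also have "\<dots> \<le> 1"
      using power_one_minus_le[of ?x "2 * k"] hit_prob_nonneg hit_prob_le_1 by simp
    finally have "1 + 2 * real k * ?x \<le> 1 / (1 - hit_prob Q 1)"
      using lt by (simp add: field_simps)
    with k have "2 * real k * ?x < real k * 1" by linarith
    then have "?x < 1/2" using k0 by simp
    then show ?thesis using that[of "2 * k"] k0 by simp
  qed
  have "\<exists>m. 1/2 \<le> hit_prob Q (real m)"
  proof -
    obtain m where "(1 - hit_prob Q 1) ^ m < 1/2"
      using real_arch_pow_inv[of "1/2" "1 - hit_prob Q 1"] pos by auto
    then show ?thesis using miss_prob_le_power[OF Q(1), of 1 m] by (intro exI[of _ m]) simp
  qed
  then obtain m where "1/2 \<le> hit_prob Q (real m)" by blast
  \<comment> \<open>The index is shifted so that the grid starts at 1/k instead of 0. Then the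
    points (j+1)/k and (j+2)/k always have ratio at most 2.\<close>
  define R where "R j \<longleftrightarrow> 1/2 \<le> hit_prob Q (real (Suc j) * (1 / real k))" for j
  have "\<not> R 0" using k by (simp add: R_def)
  have "hit_prob Q (real m) \<le> hit_prob Q (real (Suc (m * k)) * (1 / real k))"
    using k by (intro hit_prob_mono Q) (auto simp: field_simps)
  with \<open>1/2 \<le> hit_prob Q (real m)\<close> have "R (m * k)"
    by (simp add: R_def)
  moreover have "R i \<Longrightarrow> \<exists>j. \<not> R j \<and> R (Suc j)" for i
    by (induction i) (use \<open>\<not> R 0\<close> in auto)
  ultimately obtain j where j: "\<not> R j" "R (Suc j)"
    by blast
  let ?p = "real (Suc j) * (1 / real k)"
  have "hit_prob Q (real (Suc (Suc j)) * (1 / real k)) \<le> hit_prob Q (2 * ?p)"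
    using k by (intro hit_prob_mono Q) (auto simp: field_simps)
  then show ?thesis
    using j k by (intro exI[of _ ?p]) (auto simp: R_def)
qed

text \<open>Each of m independent copies misses with probability at most 1/2. The bound 2^-m is
  weakened to 1/m to match the error below the median.\<close>

lemma hit_prob_median_multiple:
  assumes "increasing Q" "0 \<le> p" "1/2 \<le> hit_prob Q p" "0 < m"
  shows "1 - 1 / real m \<le> hit_prob Q (real m * p)"
proof -
  have "1 - hit_prob Q (real m * p) \<le> (1 - hit_prob Q p) ^ m"
    using assms by (intro miss_prob_le_power)
  also have "\<dots> \<le> (1/2) ^ m"
    using assms hit_prob_le_1[of Q p] by (intro power_mono) auto
  also have "\<dots> \<le> 1 / real m"
    using of_nat_less_two_power[of m, where 'a = real] assms(4) by (simp add: field_simps)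
  finally show ?thesis by simp
qed

text \<open>The union of m copies at p/m is a copy at p, which misses with probability at least 1/2;
  so (1-x)^m is at least 1/2, which forces 1 + mx to be at most 2.\<close>

lemma hit_prob_median_fraction:
  assumes "increasing Q" "0 \<le> p" "hit_prob Q p \<le> 1/2" "0 < m"
  shows "hit_prob Q (p / real m) \<le> 1 / real m"
proof -
  let ?x = "hit_prob Q (p / real m)"
  have "1/2 \<le> (1 - ?x) ^ m"
    using miss_prob_le_power[OF assms(1), of "p / real m" m] assms by simp
  then have "1/2 * (1 + real m * ?x) \<le> (1 - ?x) ^ m * (1 + real m * ?x)"
    using hit_prob_nonneg by (intro mult_right_mono) auto
  also have "\<dots> \<le> 1"
    by (intro power_one_minus_le hit_prob_nonneg hit_prob_le_1)
  finally show ?thesis using assms(4) by (simp add: field_simps)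
qed

subsection \<open>Slicing the exponential product measure into simplices\<close>

abbreviation L :: "('i \<Rightarrow> real) measure" where
  "L \<equiv> \<Pi>\<^sub>M e\<in>I. lborel"

definition weight :: "('i \<Rightarrow> real) \<Rightarrow> real" where
  "weight X = (\<Sum>e\<in>I. a e * X e)"

definition orthant :: "('i \<Rightarrow> real) set" where
  "orthant = (\<Pi>\<^sub>E e\<in>I. {0..})"

definition scaled_simplex :: "real \<Rightarrow> ('i \<Rightarrow> real) set" where
  "scaled_simplex t = {X \<in> orthant. weight X \<le> t}"

text \<open>The event lives on the whole space, so that one and the same set can be intersected with
  the slices \<open>scaled_simplex t\<close> for all t.\<close>

definition hit :: "'i set set \<Rightarrow> real \<Rightarrow> ('i \<Rightarrow> real) set" where
  "hit Q p = {X \<in> space L. {e \<in> I. X e \<le> p} \<in> Q}"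

lemma prod_a_pos: "0 < (\<Prod>e\<in>I. a e)"
  using a_pos by (rule prod_pos)

lemma weight_measurable [measurable]: "weight \<in> borel_measurable L"
  unfolding weight_def by measurable

lemma orthant_sets [measurable]: "orthant \<in> sets L"
  unfolding orthant_def by (rule sets_PiM_I_finite) (auto simp: finite_I)

lemma orthant_subset: "orthant \<subseteq> space L"
  using sets.sets_into_space[OF orthant_sets] .

lemma scaled_simplex_sets [measurable]: "scaled_simplex t \<in> sets L"
proof -
  have "scaled_simplex t = orthant \<inter> {X \<in> space L. weight X \<le> t}"
    using orthant_subset by (auto simp: scaled_simplex_def)
  then show ?thesis by simp
qed

lemma hit_sets [measurable]: "hit Q p \<in> sets L"
proof -
  have "hit Q p = (\<Union>S\<in>Pow I \<inter> Q. {X \<in> space L. \<forall>e\<in>I. X e \<le> p \<longleftrightarrow> e \<in> S})" (is "_ = ?U")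
  proof (intro equalityI subsetI)
    fix X assume "X \<in> hit Q p"
    then show "X \<in> ?U"
      by (auto simp: hit_def intro!: bexI[of _ "{e \<in> I. X e \<le> p}"])
  next
    fix X assume "X \<in> ?U"
    then obtain S where S: "S \<subseteq> I" "S \<in> Q" "X \<in> space L" "\<forall>e\<in>I. X e \<le> p \<longleftrightarrow> e \<in> S" by auto
    then have "{e \<in> I. X e \<le> p} = S" by auto
    with S show "X \<in> hit Q p" by (simp add: hit_def)
  qed
  also have "\<dots> \<in> sets L"
  proof (rule sets.finite_UN)
    show "finite (Pow I \<inter> Q)" by (simp add: finite_I)
    fix S
    show "{X \<in> space L. \<forall>e\<in>I. X e \<le> p \<longleftrightarrow> e \<in> S} \<in> sets L"
      using finite_I by measurable
  qed
  finally show ?thesis .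
qed

text \<open>Splitting by the set S of coordinates at most p makes the integrand a product over
  coordinates. Each factor is the probability of a clock ringing before or after p, divided by the
  missing normalization \<open>a e\<close>.\<close>

lemma nn_integral_exp_hit:
  assumes "0 \<le> p"
  shows "(\<integral>\<^sup>+X. indicator (hit Q p \<inter> orthant) X * ennreal (exp (- weight X)) \<partial>L) =
    ennreal (hit_prob Q p / (\<Prod>e\<in>I. a e))"
proof -
  \<comment> \<open>The interval for present coordinates is closed at p and the other one open, so
    that exactly one pattern S fits each point of the orthant.\<close>
  define h where "h S e x = ennreal (exp (- a e * x)) *
    indicator (if e \<in> S then {0..p} else {p<..}) x" for S :: "'i set" and e and x :: real
  have [measurable]: "h S e \<in> borel_measurable borel" for S e
    unfolding h_def by measurable
  have eq: "indicator (hit Q p \<inter> orthant) X * ennreal (exp (- weight X)) =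
      (\<Sum>S\<in>Pow I \<inter> Q. \<Prod>e\<in>I. h S e (X e))" if X: "X \<in> space L" for X
  proof -
    let ?S = "{e \<in> I. X e \<le> p}"
    have "(\<Prod>e\<in>I. h S e (X e)) =
        (if S = ?S then (if X \<in> orthant then ennreal (exp (- weight X)) else 0) else 0)"
      if S: "S \<subseteq> I" for S
    proof (cases "S = ?S \<and> X \<in> orthant")
      case True
      then have "(\<Prod>e\<in>I. h S e (X e)) = (\<Prod>e\<in>I. ennreal (exp (- a e * X e)))"
        by (intro prod.cong) (auto simp: h_def orthant_def PiE_iff)
      also have "\<dots> = ennreal (exp (- weight X))"
        by (simp add: prod_ennreal weight_def exp_sum[OF finite_I] flip: sum_negf)
      finally show ?thesis using True by simp
    next
      case False
      have "\<exists>e\<in>I. h S e (X e) = 0"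
      proof (cases "S = ?S")
        case True
        \<comment> \<open>Since p is nonnegative, such an e belongs to the pattern S, and its factor
          vanishes because {0..p} excludes negative values.\<close>
        with False X obtain e where "e \<in> I" "X e < 0"
          by (auto simp: orthant_def space_PiM PiE_iff not_le)
        then show ?thesis using assms by (auto simp: h_def intro!: bexI[of _ e])
      next
        case False
        with S obtain e where "e \<in> I" "(e \<in> S) \<noteq> (X e \<le> p)" by blast
        then show ?thesis by (auto simp: h_def intro!: bexI[of _ e])
      qed
      then have "(\<Prod>e\<in>I. h S e (X e)) = 0"
        using finite_I by simp
      then show ?thesis using False by auto
    qed
    then have "(\<Sum>S\<in>Pow I \<inter> Q. \<Prod>e\<in>I. h S e (X e)) =
        (\<Sum>S\<in>Pow I \<inter> Q. if S = ?S then (if X \<in> orthant then ennreal (exp (- weight X)) else 0) else 0)"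
      by (intro sum.cong) auto
    also have "\<dots> = indicator (hit Q p \<inter> orthant) X * ennreal (exp (- weight X))"
      using X finite_I by (simp add: sum.delta' hit_def indicator_def)
    finally show ?thesis by simp
  qed
  have int_h: "integral\<^sup>N lborel (h S e) =
      ennreal ((if e \<in> S then 1 - exp (- a e * p) else exp (- a e * p)) / a e)" if e: "e \<in> I" for S e
  proof (cases "e \<in> S")
    case True
    then show ?thesis
      unfolding h_def using nn_integral_exp_Icc[OF a_pos[OF e] assms] by simp
  next
    case False
    have "integral\<^sup>N lborel (h S e) = (\<integral>\<^sup>+x. ennreal (exp (- a e * x)) * indicator {p..} x \<partial>lborel)"
      \<comment> \<open>The open and the closed half-line differ by the null set {p}.\<close>
      using AE_lborel_singleton[of p] False
      by (intro nn_integral_cong_AE) (auto simp: h_def indicator_def elim!: eventually_mono)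
    then show ?thesis
      using nn_integral_exp_atLeast[OF a_pos[OF e], of p] False by simp
  qed
  have "(\<integral>\<^sup>+X. indicator (hit Q p \<inter> orthant) X * ennreal (exp (- weight X)) \<partial>L) =
      (\<integral>\<^sup>+X. (\<Sum>S\<in>Pow I \<inter> Q. \<Prod>e\<in>I. h S e (X e)) \<partial>L)"
    by (intro nn_integral_cong eq)
  also have "\<dots> = (\<Sum>S\<in>Pow I \<inter> Q. \<integral>\<^sup>+X. (\<Prod>e\<in>I. h S e (X e)) \<partial>L)"
    by (intro nn_integral_sum) measurable
  also have "\<dots> = (\<Sum>S\<in>Pow I \<inter> Q. \<Prod>e\<in>I. integral\<^sup>N lborel (h S e))"
    by (intro sum.cong real_product.product_nn_integral_prod finite_I) auto
  also have "\<dots> = (\<Sum>S\<in>Pow I \<inter> Q. ennreal (pmf (random_subset p) S / (\<Prod>e\<in>I. a e)))"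
  proof (intro sum.cong refl)
    fix S assume S: "S \<in> Pow I \<inter> Q"
    have "(\<Prod>e\<in>I. integral\<^sup>N lborel (h S e)) =
        ennreal (\<Prod>e\<in>I. (if e \<in> S then 1 - exp (- a e * p) else exp (- a e * p)) / a e)"
      using a_pos assms by (subst prod_ennreal[symmetric]) (auto simp: int_h less_imp_le)
    also have "\<dots> = ennreal (pmf (random_subset p) S / (\<Prod>e\<in>I. a e))"
      using S assms by (simp add: pmf_random_subset prod_dividef)
    finally show "(\<Prod>e\<in>I. integral\<^sup>N lborel (h S e)) =
        ennreal (pmf (random_subset p) S / (\<Prod>e\<in>I. a e))" .
  qed
  also have "\<dots> = ennreal (hit_prob Q p / (\<Prod>e\<in>I. a e))"
    using prod_a_pos by (simp add: sum_ennreal hit_prob_eq_sum sum_divide_distrib)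
  finally show ?thesis .
qed

lemma weight_nonneg: "X \<in> orthant \<Longrightarrow> 0 \<le> weight X"
  unfolding weight_def orthant_def using a_pos
  by (intro sum_nonneg mult_nonneg_nonneg) (auto simp: PiE_iff less_imp_le)

text \<open>Layer-cake formula: exp(- weight X) is the integral of exp(-t) over t from
  \<open>weight X\<close> on. After exchanging the integrals, the points with weight at most t form
  a simplex.\<close>

lemma nn_integral_exp_layers:
  assumes A[measurable]: "A \<in> sets L"
  shows "(\<integral>\<^sup>+X. indicator (A \<inter> orthant) X * ennreal (exp (- weight X)) \<partial>L) =
    (\<integral>\<^sup>+t. ennreal (exp (- t)) * indicator {0..} t * emeasure L (A \<inter> scaled_simplex t) \<partial>lborel)"
proof -
  interpret sigma_finite_measure L
    by (rule real_product.sigma_finite[OF finite_I])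
  interpret pair_sigma_finite L "lborel :: real measure" ..
  let ?f = "\<lambda>X t. indicator (A \<inter> orthant) X * (ennreal (exp (- t)) * (if weight X \<le> t then 1 else 0)) :: ennreal"
  have "(\<integral>\<^sup>+X. indicator (A \<inter> orthant) X * ennreal (exp (- weight X)) \<partial>L) =
      (\<integral>\<^sup>+X. \<integral>\<^sup>+t. ?f X t \<partial>lborel \<partial>L)"
  proof (rule nn_integral_cong)
    fix X assume "X \<in> space L"
    have "(\<integral>\<^sup>+t. ?f X t \<partial>lborel) =
        indicator (A \<inter> orthant) X * (\<integral>\<^sup>+t. ennreal (exp (- 1 * t)) * indicator {weight X..} t \<partial>lborel)"
      by (subst nn_integral_cmult[symmetric]) (auto intro!: nn_integral_cong simp: indicator_def)
    then show "indicator (A \<inter> orthant) X * ennreal (exp (- weight X)) = (\<integral>\<^sup>+t. ?f X t \<partial>lborel)"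
      by (simp add: nn_integral_exp_atLeast[of 1, simplified])
  qed
  also have "\<dots> = (\<integral>\<^sup>+t. \<integral>\<^sup>+X. ?f X t \<partial>L \<partial>lborel)"
    by (rule Fubini'[symmetric]) measurable
  also have "\<dots> = (\<integral>\<^sup>+t. ennreal (exp (- t)) * indicator {0..} t * emeasure L (A \<inter> scaled_simplex t) \<partial>lborel)"
  proof (rule nn_integral_cong)
    fix t :: real
    have "(\<integral>\<^sup>+X. ?f X t \<partial>L) =
        (\<integral>\<^sup>+X. ennreal (exp (- t)) * indicator {0..} t * indicator (A \<inter> scaled_simplex t) X \<partial>L)"
      \<comment> \<open>Weights are nonnegative on the orthant, so slices with t < 0 are empty;
        hence the indicator of {0..}.\<close>
      using weight_nonneg
      by (intro nn_integral_cong) (force simp: scaled_simplex_def indicator_def)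
    then show "(\<integral>\<^sup>+X. ?f X t \<partial>L) =
        ennreal (exp (- t)) * indicator {0..} t * emeasure L (A \<inter> scaled_simplex t)"
      by (simp add: nn_integral_cmult)
  qed
  finally show ?thesis .
qed

text \<open>Dilation by c carries the slice at t to the slice at ct and leaves the set of present
  indices unchanged when p becomes cp.\<close>

lemma emeasure_hit_simplex_scale:
  assumes "0 < c"
  shows "emeasure L (hit Q (c * p) \<inter> scaled_simplex (c * t)) =
    ennreal (c ^ card I) * emeasure L (hit Q p \<inter> scaled_simplex t)"
proof -
  let ?s = "\<lambda>X. \<lambda>e\<in>I. c * X e"
  have [measurable]: "?s \<in> measurable L L"
    by (intro measurable_restrict) measurable
  have "weight (?s X) = c * weight X" for X
    by (simp add: weight_def sum_distrib_left mult_ac)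
  moreover have "{e \<in> I. ?s X e \<le> c * p} = {e \<in> I. X e \<le> p}" for X
    using assms by auto
  moreover have "?s X \<in> orthant \<longleftrightarrow> X \<in> orthant" if "X \<in> space L" for X
    using assms that by (auto simp: orthant_def PiE_iff space_PiM zero_le_mult_iff)
  moreover have "?s X \<in> space L" for X
    by (auto simp: space_PiM)
  ultimately have pre: "?s -` (hit Q (c * p) \<inter> scaled_simplex (c * t)) \<inter> space L = hit Q p \<inter> scaled_simplex t"
    using assms by (auto simp: hit_def scaled_simplex_def)
  have "emeasure L (hit Q (c * p) \<inter> scaled_simplex (c * t)) =
      emeasure (scale_measure (ennreal (c ^ card I)) (distr L L ?s)) (hit Q (c * p) \<inter> scaled_simplex (c * t))"
    using scale_PiM_lborel[OF finite_I assms] by simp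
  also have "\<dots> = ennreal (c ^ card I) * emeasure L (hit Q p \<inter> scaled_simplex t)"
    by (simp add: emeasure_distr pre[unfolded vimage_Int])
  finally show ?thesis .
qed

text \<open>Rescaling the slice at t to the simplex of size N costs a volume factor (t/N)^N and
  moves p to pN/t. The product exp(-t) t^N / N! is the Gamma density of shape N + 1, which leaves
  the constant N! / N^N.\<close>

lemma nn_integral_erlang_hit:
  assumes "I \<noteq> {}" "0 \<le> p"
  defines "N \<equiv> card I"
  shows "ennreal (hit_prob Q p / (\<Prod>e\<in>I. a e)) =
    (\<integral>\<^sup>+t. ennreal (fact N / real N ^ N) * (ennreal (erlang_density N 1 t) *
       emeasure L (hit Q (p * real N / t) \<inter> scaled_simplex (real N))) \<partial>lborel)"
proof -
  have N: "0 < real N"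
    using assms finite_I by (simp add: card_gt_0_iff)
  have "ennreal (hit_prob Q p / (\<Prod>e\<in>I. a e)) =
      (\<integral>\<^sup>+t. ennreal (exp (- t)) * indicator {0..} t * emeasure L (hit Q p \<inter> scaled_simplex t) \<partial>lborel)"
    using nn_integral_exp_hit[OF assms(2)] nn_integral_exp_layers[OF hit_sets] by simp
  also have "\<dots> = (\<integral>\<^sup>+t. ennreal (fact N / real N ^ N) * (ennreal (erlang_density N 1 t) *
       emeasure L (hit Q (p * real N / t) \<inter> scaled_simplex (real N))) \<partial>lborel)"
  \<comment> \<open>The point t = 0 admits no rescaling and is discarded as a null set; for t < 0
    both integrands vanish.\<close>
  proof (rule nn_integral_cong_AE, rule eventually_mono[OF AE_lborel_singleton[of 0]])
    fix t :: real
    assume t: "t \<noteq> 0"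
    show "ennreal (exp (- t)) * indicator {0..} t * emeasure L (hit Q p \<inter> scaled_simplex t) =
      ennreal (fact N / real N ^ N) * (ennreal (erlang_density N 1 t) *
       emeasure L (hit Q (p * real N / t) \<inter> scaled_simplex (real N)))"
    proof (cases "0 < t")
      case True
      have "emeasure L (hit Q p \<inter> scaled_simplex t) =
          ennreal ((t / real N) ^ N) * emeasure L (hit Q (p * real N / t) \<inter> scaled_simplex (real N))"
        using emeasure_hit_simplex_scale[of "t / real N" Q "p * real N / t" "real N"] True N
        by (simp add: N_def)
      moreover have "exp (- t) * (t / real N) ^ N = fact N / real N ^ N * erlang_density N 1 t"
        using True by (simp add: erlang_density_def power_divide)
      then have "ennreal (exp (- t)) * ennreal ((t / real N) ^ N) =
          ennreal (fact N / real N ^ N) * ennreal (erlang_density N 1 t)"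
        using True by (subst (1 2) ennreal_mult[symmetric]) auto
      ultimately show ?thesis
        using True by (simp add: mult.assoc[symmetric])
    next
      case False
      with t show ?thesis by (simp add: erlang_density_def)
    qed
  qed
  finally show ?thesis .
qed

lemma hit_UNIV: "hit UNIV p = space L"
  by (simp add: hit_def)

text \<open>The slicing formula for the trivial family \<open>UNIV\<close> has hitting probability 1
  on the left and only the total mass of a density on the right, so the volume can be read
  off.\<close>

lemma emeasure_scaled_simplex:
  assumes "I \<noteq> {}"
  defines "N \<equiv> card I"
  shows "emeasure L (scaled_simplex (real N)) = ennreal (real N ^ N / (fact N * (\<Prod>e\<in>I. a e)))"
proof -
  have N: "0 < real N"
    using assms finite_I by (simp add: card_gt_0_iff)
  let ?V = "emeasure L (scaled_simplex (real N))"
  have int: "hit UNIV p \<inter> scaled_simplex s = scaled_simplex s" for p s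
    using sets.sets_into_space[OF scaled_simplex_sets] by (auto simp: hit_UNIV)
  have "ennreal (1 / (\<Prod>e\<in>I. a e)) =
      (\<integral>\<^sup>+t. ennreal (fact N / real N ^ N) * (ennreal (erlang_density N 1 t) * ?V) \<partial>lborel)"
    using nn_integral_erlang_hit[OF assms(1), of 0 UNIV] by (simp add: hit_prob_def int N_def)
  also have "\<dots> = ennreal (fact N / real N ^ N) * ?V"
    by (simp add: nn_integral_cmult nn_integral_multc nn_integral_erlang_density_eq_1)
  finally have "ennreal (real N ^ N / fact N) * ennreal (1 / (\<Prod>e\<in>I. a e)) =
      ennreal (real N ^ N / fact N) * ennreal (fact N / real N ^ N) * ?V"
    by (simp add: mult.assoc)
  also have "\<dots> = ?V"
    using N by (simp add: ennreal_mult[symmetric])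
  finally show ?thesis
    using prod_a_pos by (simp add: ennreal_mult[symmetric] less_imp_le)
qed

section \<open>Comparison of the simplex model with the independent model\<close>

definition simplex_prob :: "'i set set \<Rightarrow> real \<Rightarrow> real" where
  "simplex_prob Q p = measure L (hit Q p \<inter> scaled_simplex (real (card I))) /
     measure L (scaled_simplex (real (card I)))"

lemma volume_pos:
  assumes "I \<noteq> {}"
  shows "0 < measure L (scaled_simplex (real (card I)))"
  using emeasure_scaled_simplex[OF assms] prod_a_pos finite_I assms
  by (simp add: measure_def card_gt_0_iff)

lemma volume_fmeasurable:
  assumes "I \<noteq> {}"
  shows "scaled_simplex (real (card I)) \<in> fmeasurable L"
  using emeasure_scaled_simplex[OF assms] by (intro fmeasurableI) auto

lemma simplex_prob_mono:
  assumes "I \<noteq> {}" "increasing Q" "p \<le> q"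
  shows "simplex_prob Q p \<le> simplex_prob Q q"
proof -
  have "hit Q p \<subseteq> hit Q q"
  proof
    fix X assume X: "X \<in> hit Q p"
    have "{e \<in> I. X e \<le> p} \<subseteq> {e \<in> I. X e \<le> q}"
      using assms(3) by auto
    with X assms(2) show "X \<in> hit Q q"
      unfolding hit_def increasing_def by blast
  qed
  then show ?thesis
    unfolding simplex_prob_def using volume_fmeasurable[OF assms(1)]
    by (intro divide_right_mono measure_mono_fmeasurable) (auto simp: Int_commute[of "hit _ _"] fmeasurable_Int_fmeasurable)
qed

lemma simplex_prob_nonneg: "0 \<le> simplex_prob Q p"
  by (simp add: simplex_prob_def)

lemma simplex_prob_le_1:
  assumes "I \<noteq> {}"
  shows "simplex_prob Q p \<le> 1"
  unfolding simplex_prob_def using volume_pos[OF assms] volume_fmeasurable[OF assms]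
  by (simp add: measure_mono_fmeasurable)

text \<open>Normalizing the slicing formula: N! / N^N times the volume of the simplex is exactly the
  factor 1 / prod a on the left, which cancels.\<close>

lemma hit_prob_eq_mixture:
  assumes "I \<noteq> {}" "increasing Q" "0 \<le> p"
  defines "N \<equiv> card I"
  shows "ennreal (hit_prob Q p) =
    (\<integral>\<^sup>+t. ennreal (simplex_prob Q (p * real N / t)) \<partial>density lborel (erlang_density N 1))"
proof -
  have N: "0 < real N"
    using assms finite_I by (simp add: card_gt_0_iff)
  let ?c = "1 / (\<Prod>e\<in>I. a e)"
  have c: "0 < ?c"
    using prod_a_pos by simp
  have V: "measure L (scaled_simplex (real N)) = real N ^ N / (fact N * (\<Prod>e\<in>I. a e))"
    using emeasure_scaled_simplex[OF assms(1)] prod_a_pos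
    by (simp add: measure_def N_def less_imp_le)
  \<comment> \<open>Monotonicity in p supplies the Borel measurability of the integrand.\<close>
  have "mono (simplex_prob Q)"
    by (intro monoI simplex_prob_mono assms)
  then have [measurable]: "simplex_prob Q \<in> borel_measurable borel"
    by (rule borel_measurable_mono)
  have "ennreal (fact N / real N ^ N) * emeasure L (hit Q q \<inter> scaled_simplex (real N)) =
      ennreal ?c * ennreal (simplex_prob Q q)" for q
  proof -
    have "hit Q q \<inter> scaled_simplex (real N) \<in> fmeasurable L"
      unfolding N_def Int_commute[of "hit Q q"]
      by (intro fmeasurable_Int_fmeasurable volume_fmeasurable assms(1) hit_sets)
    then have "emeasure L (hit Q q \<inter> scaled_simplex (real N)) =
        ennreal (measure L (hit Q q \<inter> scaled_simplex (real N)))"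
      by (rule emeasure_eq_measure2)
    also have "measure L (hit Q q \<inter> scaled_simplex (real N)) =
        measure L (scaled_simplex (real N)) * simplex_prob Q q"
      using volume_pos[OF assms(1)] by (simp add: simplex_prob_def N_def)
    finally show ?thesis
      using N c unfolding V by (simp add: ennreal_mult[symmetric] simplex_prob_nonneg)
  qed
  then have "ennreal (hit_prob Q p / (\<Prod>e\<in>I. a e)) =
    (\<integral>\<^sup>+t. ennreal ?c * (ennreal (erlang_density N 1 t) * ennreal (simplex_prob Q (p * real N / t))) \<partial>lborel)"
    unfolding nn_integral_erlang_hit[OF assms(1,3)] N_def[symmetric]
    by (simp add: mult.left_commute[of "ennreal (fact N / real N ^ N)"] mult.left_commute[of "ennreal ?c"])
  also have "\<dots> = ennreal ?c *
      (\<integral>\<^sup>+t. ennreal (simplex_prob Q (p * real N / t)) \<partial>density lborel (erlang_density N 1))"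
    by (simp add: nn_integral_cmult nn_integral_density)
  also have "ennreal (hit_prob Q p / (\<Prod>e\<in>I. a e)) = ennreal ?c * ennreal (hit_prob Q p)"
    using c by (simp add: ennreal_mult[symmetric] hit_prob_nonneg)
  finally show ?thesis
    using c by (simp add: ennreal_mult_cancel_left)
qed

text \<open>Outside the Gamma tail event the argument pN/t of the mixture lies in [p/2, 2p], where
  monotonicity applies. On the tail event the probabilities are at most 1, so it contributes at most
  its own mass.\<close>

lemma simplex_prob_comparison:
  assumes "2 \<le> card I" "increasing Q" "0 \<le> p"
  shows "simplex_prob Q (p / 2) \<le> hit_prob Q p + gamma_tail_bound (card I)"
    and "hit_prob Q p \<le> simplex_prob Q (2 * p) + gamma_tail_bound (card I)"
proof -
  define N where "N = card I"
  have ne: "I \<noteq> {}" and N: "2 \<le> real N"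
    using assms by (auto simp: N_def)
  let ?D = "density lborel (erlang_density N 1)"
  let ?B = "{t. real N / 2 \<le> \<bar>t - real (N + 1)\<bar>}"
  interpret D: prob_space ?D
    by (rule prob_space_erlang_density) simp
  have "mono (simplex_prob Q)"
    by (intro monoI simplex_prob_mono assms ne)
  then have [measurable]: "simplex_prob Q \<in> borel_measurable borel"
    by (rule borel_measurable_mono)
  have B: "emeasure ?D ?B \<le> ennreal (gamma_tail_bound N)"
    using erlang_tail[of N] N by simp
  have err: "0 \<le> gamma_tail_bound N" by (simp add: gamma_tail_bound_def)
  have near: "p / 2 \<le> p * real N / t \<and> p * real N / t \<le> 2 * p" if "t \<notin> ?B" for t
  proof -
    have "\<bar>t - real (N + 1)\<bar> < real N / 2"
      using that by (simp only: mem_Collect_eq not_le)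
    \<comment> \<open>The deviation bound gives t < 3N/2 + 1, and this is at most 2N because N is at
      least 2.\<close>
    then have t: "real N / 2 < t" "t < 2 * real N"
      using N by linarith+
    then have "1 / 2 \<le> real N / t" "real N / t \<le> 2" using N by (auto simp: field_simps)
    from mult_left_mono[OF this(1) assms(3)] mult_left_mono[OF this(2) assms(3)]
    show ?thesis by simp
  qed
  have mix: "ennreal (hit_prob Q p) = (\<integral>\<^sup>+t. ennreal (simplex_prob Q (p * real N / t)) \<partial>?D)"
    unfolding N_def by (rule hit_prob_eq_mixture) (use assms ne in auto)
  have "ennreal (simplex_prob Q (p / 2)) = (\<integral>\<^sup>+t. ennreal (simplex_prob Q (p / 2)) \<partial>?D)"
    by (simp add: D.emeasure_space_1 del: space_density)
  also have "\<dots> \<le> (\<integral>\<^sup>+t. ennreal (simplex_prob Q (p * real N / t)) + indicator ?B t \<partial>?D)"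
  proof (rule nn_integral_mono)
    fix t show "ennreal (simplex_prob Q (p / 2)) \<le> ennreal (simplex_prob Q (p * real N / t)) + indicator ?B t"
    proof (cases "t \<in> ?B")
      case True
      have "ennreal (simplex_prob Q (p / 2)) \<le> 1"
        using simplex_prob_le_1[OF ne] by simp
      then show ?thesis using True by (simp add: add_increasing)
    next
      case False
      with near[OF False] show ?thesis
        using simplex_prob_mono[OF ne assms(2)] by (simp add: ennreal_leI)
    qed
  qed
  also have "\<dots> = ennreal (hit_prob Q p) + emeasure ?D ?B"
    by (simp add: nn_integral_add mix)
  also have "\<dots> \<le> ennreal (hit_prob Q p) + ennreal (gamma_tail_bound N)"
    using B by (rule add_left_mono)
  finally show "simplex_prob Q (p / 2) \<le> hit_prob Q p + gamma_tail_bound (card I)"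
    using err hit_prob_nonneg unfolding N_def by (simp flip: ennreal_plus)
  have "ennreal (hit_prob Q p) \<le> (\<integral>\<^sup>+t. ennreal (simplex_prob Q (2 * p)) + indicator ?B t \<partial>?D)"
    unfolding mix
  proof (rule nn_integral_mono)
    fix t show "ennreal (simplex_prob Q (p * real N / t)) \<le> ennreal (simplex_prob Q (2 * p)) + indicator ?B t"
    proof (cases "t \<in> ?B")
      case True
      have "ennreal (simplex_prob Q (p * real N / t)) \<le> 1"
        using simplex_prob_le_1[OF ne] by simp
      then show ?thesis using True by (simp add: add_increasing)
    next
      case False
      with near[OF False] show ?thesis
        using simplex_prob_mono[OF ne assms(2)] by (simp add: ennreal_leI)
    qed
  qed
  also have "\<dots> = ennreal (simplex_prob Q (2 * p)) + emeasure ?D ?B"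
    by (simp add: nn_integral_add D.emeasure_space_1 del: space_density)
  also have "\<dots> \<le> ennreal (simplex_prob Q (2 * p)) + ennreal (gamma_tail_bound N)"
    using B by (rule add_left_mono)
  finally show "hit_prob Q p \<le> simplex_prob Q (2 * p) + gamma_tail_bound (card I)"
    using err simplex_prob_nonneg unfolding N_def by (simp flip: ennreal_plus)
qed

text \<open>With p0 from the median lemma, the lower scale p0/(2m) is a fraction p0/m halved by the
  comparison. The upper scale 4m p0 is m times the upper median point 2 p0, doubled by the
  comparison. One p0 serves all m.\<close>

lemma ex_threshold_point:
  assumes "2 \<le> card I" "increasing Q" "I \<in> Q" "{} \<notin> Q"
  shows "\<exists>p0>0. \<forall>m>0. \<forall>p.
    (p \<le> p0 / (2 * real m) \<longrightarrow> simplex_prob Q p \<le> 1 / real m + gamma_tail_bound (card I)) \<and>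
    (4 * real m * p0 \<le> p \<longrightarrow> 1 - 1 / real m - gamma_tail_bound (card I) \<le> simplex_prob Q p)"
proof -
  have ne: "I \<noteq> {}" using assms by auto
  obtain p0 where p0: "0 < p0" "hit_prob Q p0 \<le> 1/2" "1/2 \<le> hit_prob Q (2 * p0)"
    using ex_median assms by blast
  have "simplex_prob Q p \<le> 1 / real m + gamma_tail_bound (card I)" if "0 < m" "p \<le> p0 / (2 * real m)" for m p
  proof -
    have "simplex_prob Q p \<le> simplex_prob Q ((p0 / real m) / 2)"
      using that by (intro simplex_prob_mono ne assms) (simp add: mult.commute)
    also have "\<dots> \<le> hit_prob Q (p0 / real m) + gamma_tail_bound (card I)"
      using p0 assms by (intro simplex_prob_comparison) auto
    also have "hit_prob Q (p0 / real m) \<le> 1 / real m"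
      using p0 assms that by (intro hit_prob_median_fraction) auto
    finally show ?thesis by simp
  qed
  moreover have "1 - 1 / real m - gamma_tail_bound (card I) \<le> simplex_prob Q p" if "0 < m" "4 * real m * p0 \<le> p" for m p
  proof -
    have "1 - 1 / real m \<le> hit_prob Q (real m * (2 * p0))"
      using p0 assms that by (intro hit_prob_median_multiple) auto
    also have "\<dots> \<le> simplex_prob Q (2 * (real m * (2 * p0))) + gamma_tail_bound (card I)"
      using p0 assms by (intro simplex_prob_comparison) auto
    also have "simplex_prob Q (2 * (real m * (2 * p0))) \<le> simplex_prob Q p"
      using that by (intro simplex_prob_mono ne assms) simp
    finally show ?thesis by simp
  qed
  ultimately show ?thesis using p0(1) by blast
qed

end

subsection \<open>Graph properties\<close>

lemma finite_edge_pairs: "finite (edge_pairs n)"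
  by (simp add: edge_pairs_def finite_imp_finite_nsets)

lemma card_edge_pairs: "card (edge_pairs n) = n choose 2"
  by (simp add: edge_pairs_def)

lemma exponential_weights_edge_pairs:
  assumes "M_bounded K n b"
  shows "exponential_weights (edge_pairs n) b"
proof
  fix e assume "e \<in> edge_pairs n"
  with assms have "0 < 1 / K" "1 / K \<le> b e" by (auto simp: M_bounded_def)
  then show "0 < b e" by linarith
qed (rule finite_edge_pairs)

definition edge_sets :: "nat graph set \<Rightarrow> nat \<Rightarrow> nat set set set" where
  "edge_sets P n = {S. ({1..n}, S) \<in> P}"

text \<open>Both sides are the same ratio of volumes, as the bound n choose 2 on the weight is the
  number of coordinates. For n at least 2 the index set is nonempty and the simplex has positive
  finite volume.\<close>

lemma prob_property_eq:
  assumes "M_bounded K n b" "2 \<le> n"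
  shows "prob_property n b p P = exponential_weights.simplex_prob (edge_pairs n) b (edge_sets P n) p"
proof -
  interpret exponential_weights "edge_pairs n" b
    by (rule exponential_weights_edge_pairs[OF assms(1)])
  have ne: "edge_pairs n \<noteq> {}"
    using assms(2) card_edge_pairs[of n] by (auto simp: zero_less_binomial)
  have S: "weighted_simplex n b = scaled_simplex (real (card (edge_pairs n)))"
    by (simp add: weighted_simplex_def scaled_simplex_def orthant_def weight_def card_edge_pairs)
  have H: "{X \<in> space (uniform_simplex n b). simplex_graph n p X \<in> P} = hit (edge_sets P n) p"
    by (simp add: uniform_simplex_def simplex_graph_def hit_def edge_sets_def)
  \<comment> \<open>Positivity of \<open>measure\<close> excludes both values at once, since
    \<open>measure\<close> is 0 also where \<open>emeasure\<close> is infinite.\<close>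
  have "emeasure L (weighted_simplex n b) \<noteq> 0" "emeasure L (weighted_simplex n b) \<noteq> \<infinity>"
    using volume_pos[OF ne] by (auto simp: S measure_def)
  then show ?thesis
    unfolding prob_property_def H unfolding uniform_simplex_def simplex_prob_def
    by (subst measure_uniform_measure) (auto simp: S Int_commute)
qed

lemma increasing_edge_sets:
  assumes "M_bounded K n b" "monotone_increasing P"
  shows "exponential_weights.increasing (edge_pairs n) (edge_sets P n)"
  using assms(2)
  unfolding exponential_weights.increasing_def[OF exponential_weights_edge_pairs[OF assms(1)]]
  unfolding monotone_increasing_def simple_graph_def edge_sets_def edge_pairs_def by auto

text \<open>Some graph with the property lies below the complete graph; and if the empty graph had
  the property, so would every graph on {1..n}.\<close>

lemma edge_sets_nontrivial:
  assumes "monotone_increasing P" "nontrivial_property P" "2 \<le> n"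
  shows "edge_pairs n \<in> edge_sets P n" "{} \<notin> edge_sets P n"
proof -
  obtain E where "simple_graph ({1..n}, E)" "({1..n}, E) \<in> P"
    using assms by (auto simp: nontrivial_property_def)
  with assms(1) show "edge_pairs n \<in> edge_sets P n"
    unfolding monotone_increasing_def simple_graph_def edge_sets_def edge_pairs_def by auto
  obtain E where "simple_graph ({1..n}, E)" "({1..n}, E) \<notin> P"
    using assms by (auto simp: nontrivial_property_def)
  with assms(1) show "{} \<notin> edge_sets P n"
    unfolding monotone_increasing_def edge_sets_def by auto
qed

text \<open>Gives at least two pairs once n is at least 3, and divergence of the number of
  pairs.\<close>

lemma choose_2_ge: "n - 1 \<le> n choose 2"
  by (cases n) (simp_all add: numeral_2_eq_2)

lemma gamma_tail_bound_choose_tendsto_0: "(\<lambda>n. gamma_tail_bound (n choose 2)) \<longlonglongrightarrow> 0"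
proof -
  have "filterlim (\<lambda>n. n choose 2) at_top sequentially"
  proof (rule filterlim_at_top_mono[of "\<lambda>n. n - 1"])
    show "filterlim (\<lambda>n. n - 1 :: nat) at_top sequentially"
      by (rule filterlim_minus_const_nat_at_top)
    show "eventually (\<lambda>n. n - 1 \<le> n choose 2) sequentially"
      by (intro always_eventually allI choose_2_ge)
  qed
  moreover have "(\<lambda>N. 4 * (real N + 1) / real N ^ 2) \<longlonglongrightarrow> 0"
    by real_asymp
  ultimately show ?thesis
    unfolding gamma_tail_bound_def by (rule filterlim_compose[rotated])
qed

theorem theorem2p8:
  fixes M :: "nat \<Rightarrow> real"
    and \<alpha> :: "nat \<Rightarrow> nat set \<Rightarrow> real"
    and P :: "nat graph set"
  assumes "M \<in> O(\<lambda>_. 1)"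
    and "\<And>n. M_bounded (M n) n (\<alpha> n)"
    and "graph_property P"
    and "monotone_increasing P"
    and "nontrivial_property P"
  shows "\<exists>p0. is_threshold \<alpha> P p0"
proof -
  let ?f = "\<lambda>n p. prob_property n (\<alpha> n) p P"
  have range: "0 \<le> ?f n p \<and> ?f n p \<le> 1" if "2 \<le> n" for n p
  proof -
    interpret exponential_weights "edge_pairs n" "\<alpha> n"
      by (rule exponential_weights_edge_pairs[OF assms(2)])
    have "edge_pairs n \<noteq> {}"
      using that card_edge_pairs[of n] by (auto simp: zero_less_binomial)
    then show ?thesis
      unfolding prob_property_eq[OF assms(2) that] by (simp add: simplex_prob_nonneg simplex_prob_le_1)
  qed
  \<comment> \<open>The comparison wants two coordinates, hence n at least 3; for smaller n the
    value 1 is a positive placeholder, which no limit sees.\<close>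
  have "\<exists>p0>0. 3 \<le> n \<longrightarrow> (\<forall>m>0. \<forall>p.
      (p \<le> p0 / (2 * real m) \<longrightarrow> ?f n p \<le> 1 / real m + gamma_tail_bound (n choose 2)) \<and>
      (4 * real m * p0 \<le> p \<longrightarrow> 1 - 1 / real m - gamma_tail_bound (n choose 2) \<le> ?f n p))" for n
  proof (cases "3 \<le> n")
    case True
    interpret exponential_weights "edge_pairs n" "\<alpha> n"
      by (rule exponential_weights_edge_pairs[OF assms(2)])
    have "2 \<le> card (edge_pairs n)"
      using True choose_2_ge[of n] by (simp add: card_edge_pairs)
    from ex_threshold_point[OF this increasing_edge_sets[OF assms(2,4)]] edge_sets_nontrivial[OF assms(4,5), of n]
    show ?thesis
      using True prob_property_eq[OF assms(2), of n] by (simp add: card_edge_pairs)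
  qed (auto intro: exI[of _ 1])
  then obtain p0 where pos: "\<And>n. 0 < p0 n"
    and low: "\<And>n m p. 3 \<le> n \<Longrightarrow> 0 < m \<Longrightarrow> p \<le> p0 n / (2 * real m) \<Longrightarrow> ?f n p \<le> 1 / real m + gamma_tail_bound (n choose 2)"
    and high: "\<And>n m p. 3 \<le> n \<Longrightarrow> 0 < m \<Longrightarrow> 4 * real m * p0 n \<le> p \<Longrightarrow> 1 - 1 / real m - gamma_tail_bound (n choose 2) \<le> ?f n p"
    by metis
  have small: "eventually (\<lambda>n. 1 / real m + gamma_tail_bound (n choose 2) < \<epsilon>) sequentially"
    if "1 / real m < \<epsilon>" for m \<epsilon>
    using tendsto_add[OF tendsto_const gamma_tail_bound_choose_tendsto_0, of "1 / real m"] that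
    by (auto dest: order_tendstoD(2))
  have ex_m: "\<exists>m>0. 1 / real m < \<epsilon>" if "0 < \<epsilon>" for \<epsilon> :: real
    using reals_Archimedean[OF that] by (metis inverse_eq_divide zero_less_Suc)
  have "(\<lambda>n. ?f n (p n)) \<longlonglongrightarrow> 0" if "(\<lambda>n. p n / p0 n) \<longlonglongrightarrow> 0" for p
  proof (rule order_tendstoI)
    fix \<epsilon> :: real assume "\<epsilon> < 0"
    then show "eventually (\<lambda>n. \<epsilon> < ?f n (p n)) sequentially"
    proof (intro eventually_sequentiallyI[of 2])
      fix n :: nat assume "2 \<le> n"
      then show "\<epsilon> < ?f n (p n)" using \<open>\<epsilon> < 0\<close> range[of n "p n"] by linarith
    qed
  next
    fix \<epsilon> :: real assume "0 < \<epsilon>"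
    \<comment> \<open>The number m depends on \<epsilon> alone; the Gamma error is then absorbed by
      letting n grow.\<close>
    then obtain m where m: "0 < m" "1 / real m < \<epsilon>" using ex_m by blast
    have "eventually (\<lambda>n. p n / p0 n < 1 / (2 * real m)) sequentially"
      using that m by (intro order_tendstoD) auto
    then show "eventually (\<lambda>n. ?f n (p n) < \<epsilon>) sequentially"
      using small[OF m(2)] eventually_ge_at_top[of 3]
    proof eventually_elim
      case (elim n)
      have "p n \<le> p0 n / (2 * real m)"
        using elim(1) pos[of n] m by (simp add: field_simps)
      from low[OF elim(3) m(1) this] elim(2) show ?case by linarith
    qed
  qed
  moreover have "(\<lambda>n. ?f n (p n)) \<longlonglongrightarrow> 1" if "filterlim (\<lambda>n. p n / p0 n) at_top sequentially" for p
  proof (rule order_tendstoI)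
    fix \<epsilon> :: real assume "1 < \<epsilon>"
    then show "eventually (\<lambda>n. ?f n (p n) < \<epsilon>) sequentially"
    proof (intro eventually_sequentiallyI[of 2])
      fix n :: nat assume "2 \<le> n"
      then show "?f n (p n) < \<epsilon>" using \<open>1 < \<epsilon>\<close> range[of n "p n"] by linarith
    qed
  next
    fix \<epsilon> :: real assume "\<epsilon> < 1"
    then obtain m where m: "0 < m" "1 / real m < 1 - \<epsilon>" using ex_m[of "1 - \<epsilon>"] by auto
    \<comment> \<open>Divergence of the quotient passes every fixed multiple 4m of p0, the scale at
      which \<open>high\<close> applies.\<close>
    have "eventually (\<lambda>n. 4 * real m \<le> p n / p0 n) sequentially"
      using that by (simp add: filterlim_at_top)
    then show "eventually (\<lambda>n. \<epsilon> < ?f n (p n)) sequentially"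
      using small[OF m(2)] eventually_ge_at_top[of 3]
    proof eventually_elim
      case (elim n)
      have "4 * real m * p0 n \<le> p n"
        using elim(1) pos[of n] by (simp add: field_simps)
      from high[OF elim(3) m(1) this] elim(2) show ?case by linarith
    qed
  qed
  ultimately show ?thesis
    unfolding is_threshold_def using pos by blast
qed

end
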